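(* Let $G$ be an abstract group. The following are equivalent: (1) $G$ is left linearly orderable; (2) the discrete group $(G,\tau_{discr})$ is orderly, i.e., $G$ with the discrete topology embeds topologically (as a topological group) into $H_+(K)$ for some compact linearly ordered space $(K,\leq)$; (3) $G$ embeds algebraically (as an abstract group) into $\mathrm{Aut}(X,\leq)$ for some linearly ordered set $(X,\leq)$. Moreover, in (2) one can suppose, in addition, that $\dim K=0$.
   Context: A group $G$ is left linearly orderable if there is a linear order $\leq$ on the set $G$ such that $x\leq y\Leftrightarrow gx\leq gy$ for all $g,x,y\in G$. The interval topology of a linearly ordered set has as subbase all rays $\{x: a<x\}$, $\{x: x<b\}$. A compact linearly ordered space is a linearly ordered set whose interval topology is compact, equipped with that topology. $H_+(K)$ is the group of all order-preserving homeomorphisms $K\to K$ with the compact-open topology. $\mathrm{Aut}(X,\leq)$ is the group of all bijections $g\colon X\to X$ with $x\leq y\Leftrightarrow gx\leq gy$. A topological group is orderly if it embeds as a topological group into $H_+(K)$ for some compact linearly ordered space $K$. *)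

theory Defs
  imports "HOL-Analysis.Analysis" "HOL-Algebra.Bij"
begin

text \<open>Linearly ordered sets are carriers \<open>X\<close> with a relation \<open>r\<close> such that
  \<^term>\<open>linear_order_on X r\<close>, where \<open>(x, y) \<in> r\<close> means \<open>x \<le> y\<close>.\<close>

definition left_linearly_orderable :: "('a, 'm) monoid_scheme \<Rightarrow> bool" where
  "left_linearly_orderable G \<longleftrightarrow>
     (\<exists>r. linear_order_on (carrier G) r \<and>
          (\<forall>g\<in>carrier G. \<forall>x\<in>carrier G. \<forall>y\<in>carrier G.
             (x, y) \<in> r \<longleftrightarrow> (g \<otimes>\<^bsub>G\<^esub> x, g \<otimes>\<^bsub>G\<^esub> y) \<in> r))"

text \<open>\<open>X\<close> itself is put into the subbase (it is the empty intersection of rays); it matters only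
  when \<open>X\<close> is a singleton, where all rays are empty.\<close>

definition interval_topology :: "'b set \<Rightarrow> 'b rel \<Rightarrow> 'b topology" where
  "interval_topology X r =
     topology_generated_by
       (insert X ({{x \<in> X. (a, x) \<in> r \<and> x \<noteq> a} |a. a \<in> X} \<union>
                  {{x \<in> X. (x, b) \<in> r \<and> x \<noteq> b} |b. b \<in> X}))"

lemma topspace_interval_topology [simp]: "topspace (interval_topology X r) = X"
  by (auto simp: interval_topology_def topology_generated_by_topspace)

definition compact_linearly_ordered_space :: "'b set \<Rightarrow> 'b rel \<Rightarrow> bool" where
  "compact_linearly_ordered_space K r \<longleftrightarrow>
     linear_order_on K r \<and> compact_space (interval_topology K r)"

text \<open>Self-maps of a carrier set are represented by extensional functions, as in
  \<^const>\<open>BijGroup\<close>, whose multiplication is composition.\<close>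

definition order_Aut :: "'b set \<Rightarrow> 'b rel \<Rightarrow> ('b \<Rightarrow> 'b) monoid" where
  "order_Aut X r =
     (BijGroup X)\<lparr>carrier :=
        {h \<in> Bij X. \<forall>x\<in>X. \<forall>y\<in>X. (x, y) \<in> r \<longleftrightarrow> (h x, h y) \<in> r}\<rparr>"

definition order_Homeo :: "'b set \<Rightarrow> 'b rel \<Rightarrow> ('b \<Rightarrow> 'b) monoid" where
  "order_Homeo K r =
     (BijGroup K)\<lparr>carrier :=
        {h \<in> Bij K. homeomorphic_map (interval_topology K r) (interval_topology K r) h \<and>
           (\<forall>x\<in>K. \<forall>y\<in>K. (x, y) \<in> r \<longrightarrow> (h x, h y) \<in> r)}\<rparr>"

definition compact_open_topology :: "'b topology \<Rightarrow> 'c topology \<Rightarrow> ('b \<Rightarrow> 'c) topology" where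
  "compact_open_topology X Y =
     topology_generated_by
       {{f \<in> topspace X \<rightarrow>\<^sub>E topspace Y. continuous_map X Y f \<and> f ` C \<subseteq> U} |C U.
          compactin X C \<and> openin Y U}"

definition order_Homeo_topology :: "'b set \<Rightarrow> 'b rel \<Rightarrow> ('b \<Rightarrow> 'b) topology" where
  "order_Homeo_topology K r =
     subtopology (compact_open_topology (interval_topology K r) (interval_topology K r))
       (carrier (order_Homeo K r))"

lemma topspace_compact_open_topology:
  "topspace (compact_open_topology X Y) =
     {f \<in> topspace X \<rightarrow>\<^sub>E topspace Y. continuous_map X Y f}"
proof -
  have "{f \<in> topspace X \<rightarrow>\<^sub>E topspace Y. continuous_map X Y f} =
        {f \<in> topspace X \<rightarrow>\<^sub>E topspace Y. continuous_map X Y f \<and> f ` {} \<subseteq> {}}"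
    by simp
  then have "{f \<in> topspace X \<rightarrow>\<^sub>E topspace Y. continuous_map X Y f} \<in>
        {{f \<in> topspace X \<rightarrow>\<^sub>E topspace Y. continuous_map X Y f \<and> f ` C \<subseteq> U} |C U.
          compactin X C \<and> openin Y U}"
    using compactin_empty openin_empty by blast
  then show ?thesis
    unfolding compact_open_topology_def topology_generated_by_topspace by blast
qed

lemma topspace_order_Homeo_topology:
  "topspace (order_Homeo_topology K r) = carrier (order_Homeo K r)"
  by (auto simp: order_Homeo_topology_def topspace_compact_open_topology order_Homeo_def
      Bij_def bij_betw_def PiE_def dest: homeomorphic_imp_continuous_map)

text \<open>Being an injective homomorphism is part of this: \<^const>\<open>embedding_map\<close> means a
  homeomorphism onto the image with the subspace topology.\<close>

definition embeds_in_order_Homeo ::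
    "('a, 'm) monoid_scheme \<Rightarrow> 'a topology \<Rightarrow> 'b set \<Rightarrow> 'b rel \<Rightarrow> bool" where
  "embeds_in_order_Homeo G T K r \<longleftrightarrow>
     topspace T = carrier G \<and>
     (\<exists>f. f \<in> hom G (order_Homeo K r) \<and> embedding_map T (order_Homeo_topology K r) f)"

text \<open>HOL cannot quantify existentially over types, so the type in which the witnessing ordered set
  lives is a parameter of the next two notions.\<close>

definition orderly :: "'b itself \<Rightarrow> ('a, 'm) monoid_scheme \<Rightarrow> 'a topology \<Rightarrow> bool" where
  "orderly ty G T \<longleftrightarrow>
     (\<exists>(K :: 'b set) r. compact_linearly_ordered_space K r \<and> embeds_in_order_Homeo G T K r)"

definition embeds_in_some_order_Aut :: "'b itself \<Rightarrow> ('a, 'm) monoid_scheme \<Rightarrow> bool" where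
  "embeds_in_some_order_Aut ty G \<longleftrightarrow>
     (\<exists>(X :: 'b set) r. linear_order_on X r \<and> (\<exists>f. f \<in> mon G (order_Aut X r)))"

text \<open>Covering dimension (via finite open covers), with dimension \<open>-1\<close> exactly for the empty
  space.\<close>

definition covering_dim_le :: "'b topology \<Rightarrow> int \<Rightarrow> bool" where
  "covering_dim_le X n \<longleftrightarrow> - 1 \<le> n \<and>
     (\<forall>\<U>. finite \<U> \<and> (\<forall>U\<in>\<U>. openin X U) \<and> \<Union>\<U> = topspace X \<longrightarrow>
        (\<exists>\<V>. finite \<V> \<and> (\<forall>V\<in>\<V>. openin X V) \<and> \<Union>\<V> = topspace X \<and>
             (\<forall>V\<in>\<V>. \<exists>U\<in>\<U>. V \<subseteq> U) \<and>
             (\<forall>x\<in>topspace X. int (card {V \<in> \<V>. x \<in> V}) \<le> n + 1)))"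

definition has_covering_dim :: "'b topology \<Rightarrow> int \<Rightarrow> bool" where
  "has_covering_dim X n \<longleftrightarrow> covering_dim_le X n \<and> \<not> covering_dim_le X (n - 1)"

end

theory Submission
  imports Defs
begin

text \<open>For (3) \<open>\<Longrightarrow>\<close> (1), well-order \<open>X\<close> and compare two automorphisms lexicographically, at the first
  point where they differ; composing with an automorphism on the left does not move that point.
  For (1) \<open>\<Longrightarrow>\<close> (2), let \<open>K\<close> be the family of initial segments of \<open>(G, \<le>)\<close>, ordered by inclusion.
  It is closed under unions, hence compact. Between any two of its points there is a jump
  \<open>{y. y < x}\<close>, \<open>{y. y \<le> x}\<close>, so the clopen sets \<open>{I. x \<in> I}\<close> and their complements form a
  subbase and \<open>K\<close> is zero-dimensional. \<open>G\<close> acts on \<open>K\<close> by translations; the jump at \<open>1\<close> goes to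
  the jump at \<open>g\<close>, and requiring this of a translation is an open condition that determines \<open>g\<close>,
  so the image of \<open>G\<close> is discrete.\<close>

section \<open>Lexicographic orders on automorphism groups\<close>

lemma linear_order_onI:
  assumes "r \<subseteq> A \<times> A"
    and "\<And>x. x \<in> A \<Longrightarrow> (x, x) \<in> r"
    and "\<And>x y z. (x, y) \<in> r \<Longrightarrow> (y, z) \<in> r \<Longrightarrow> (x, z) \<in> r"
    and "\<And>x y. (x, y) \<in> r \<Longrightarrow> (y, x) \<in> r \<Longrightarrow> x = y"
    and "\<And>x y. x \<in> A \<Longrightarrow> y \<in> A \<Longrightarrow> (x, y) \<in> r \<or> (y, x) \<in> r"
  shows "linear_order_on A r"
  unfolding order_on_defs refl_on_def total_on_def trans_def antisym_def
  using assms by blast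

lemma linear_order_onD:
  assumes "linear_order_on A r"
  shows "r \<subseteq> A \<times> A"
    and "x \<in> A \<Longrightarrow> (x, x) \<in> r"
    and "(x, y) \<in> r \<Longrightarrow> (y, z) \<in> r \<Longrightarrow> (x, z) \<in> r"
    and "(x, y) \<in> r \<Longrightarrow> (y, x) \<in> r \<Longrightarrow> x = y"
    and "x \<in> A \<Longrightarrow> y \<in> A \<Longrightarrow> (x, y) \<in> r \<or> (y, x) \<in> r"
proof -
  have r: "r \<subseteq> A \<times> A" "refl_on A r" "trans r" "antisym r" "total_on A r"
    using assms by (auto simp: order_on_defs)
  show "r \<subseteq> A \<times> A" by (fact r(1))
  show refl: "x \<in> A \<Longrightarrow> (x, x) \<in> r" for x using r(2) by (simp add: refl_on_def)
  show "(x, y) \<in> r \<Longrightarrow> (y, z) \<in> r \<Longrightarrow> (x, z) \<in> r" using r(3) by (rule transD)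
  show "(x, y) \<in> r \<Longrightarrow> (y, x) \<in> r \<Longrightarrow> x = y" using r(4) by (rule antisymD)
  show "x \<in> A \<Longrightarrow> y \<in> A \<Longrightarrow> (x, y) \<in> r \<or> (y, x) \<in> r"
    using r(5) refl by (cases "x = y") (auto simp: total_on_def)
qed

lemma linear_order_on_pullback:
  assumes r: "linear_order_on B r" and f: "inj_on f A" "f ` A \<subseteq> B"
  shows "linear_order_on A {(x, y). x \<in> A \<and> y \<in> A \<and> (f x, f y) \<in> r}"
proof (rule linear_order_onI, goal_cases)
  case (3 x y z)
  then show ?case using linear_order_onD(3)[OF r] by blast
next
  case (4 x y)
  then show ?case using linear_order_onD(4)[OF r] f(1) by (auto dest: inj_onD)
next
  case (5 x y)
  then have "f x \<in> B" "f y \<in> B" using f(2) by auto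
  then show ?case using linear_order_onD(5)[OF r, of "f x" "f y"] 5 by simp
next
  case (2 x)
  then have "f x \<in> B" using f(2) by auto
  then show ?case using linear_order_onD(2)[OF r, of "f x"] 2 by simp
qed auto

text \<open>The point \<open>x\<close> is the \<open>w\<close>-first difference. The strict relation
  is taken as primitive; \<open>linear_order_on_lex\<close> adds equality afterwards.\<close>

definition lex_less :: "'i set \<Rightarrow> 'i rel \<Rightarrow> 'b rel \<Rightarrow> ('i \<Rightarrow> 'b) \<Rightarrow> ('i \<Rightarrow> 'b) \<Rightarrow> bool" where
  "lex_less X w r f g \<longleftrightarrow>
     (\<exists>x\<in>X. (\<forall>y\<in>X. (y, x) \<in> w \<and> y \<noteq> x \<longrightarrow> f y = g y) \<and> (f x, g x) \<in> r \<and> f x \<noteq> g x)"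

text \<open>The \<open>w\<close>-earlier of the two deciding points decides between \<open>f\<close>
  and \<open>h\<close>: before it all three functions agree, and at it one of the two comparisons is
  an equality unless both points coincide.\<close>

lemma lex_less_trans:
  assumes w: "well_order_on X w" and r: "linear_order_on B r"
    and "lex_less X w r f g" "lex_less X w r g h"
  shows "lex_less X w r f h"
proof -
  have lw: "linear_order_on X w" using w by (simp add: well_order_on_def)
  obtain x where x: "x \<in> X" "\<And>z. z \<in> X \<Longrightarrow> (z, x) \<in> w \<Longrightarrow> z \<noteq> x \<Longrightarrow> f z = g z"
    "(f x, g x) \<in> r" "f x \<noteq> g x"
    using assms(3) unfolding lex_less_def by blast
  obtain y where y: "y \<in> X" "\<And>z. z \<in> X \<Longrightarrow> (z, y) \<in> w \<Longrightarrow> z \<noteq> y \<Longrightarrow> g z = h z"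
    "(g y, h y) \<in> r" "g y \<noteq> h y"
    using assms(4) unfolding lex_less_def by blast
  consider "x = y" | "(x, y) \<in> w" "x \<noteq> y" | "(y, x) \<in> w" "x \<noteq> y"
    using linear_order_onD(5)[OF lw x(1) y(1)] by blast
  then show ?thesis
  proof cases
    case 1
    \<comment> \<open>Strictness survives by antisymmetry: \<open>f x = h x\<close> would squeeze
      \<open>g x\<close> between equal values.\<close>
    have "(f x, h x) \<in> r" "f x \<noteq> h x"
      using x(3,4) y(3) 1 linear_order_onD(3,4)[OF r] by metis+
    then show ?thesis using x y 1 unfolding lex_less_def by (intro bexI[of _ x]) auto
  next
    case 2
    have "\<forall>z\<in>X. (z, x) \<in> w \<and> z \<noteq> x \<longrightarrow> f z = h z"
      using x(2) y(2) 2 linear_order_onD(3,4)[OF lw] by metis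
    moreover have "g x = h x" using y(2) 2 x(1) by blast
    ultimately show ?thesis using x unfolding lex_less_def by (intro bexI[of _ x]) auto
  next
    case 3
    have "\<forall>z\<in>X. (z, y) \<in> w \<and> z \<noteq> y \<longrightarrow> f z = h z"
      using x(2) y(2) 3 linear_order_onD(3,4)[OF lw] by metis
    moreover have "f y = g y" using x(2) 3 y(1) by blast
    ultimately show ?thesis using y unfolding lex_less_def by (intro bexI[of _ y]) auto
  qed
qed

lemma lex_less_irrefl: "\<not> lex_less X w r f f"
  by (simp add: lex_less_def)

lemma lex_less_total:
  assumes w: "well_order_on X w" and r: "linear_order_on B r"
    and f: "f \<in> X \<rightarrow>\<^sub>E B" and g: "g \<in> X \<rightarrow>\<^sub>E B" and "f \<noteq> g"
  shows "lex_less X w r f g \<or> lex_less X w r g f"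
proof -
  let ?D = "{x \<in> X. f x \<noteq> g x}"
  \<comment> \<open>Both functions are extensional, so they can differ only inside \<open>X\<close>;
    well-foundedness of \<open>w - Id\<close> then supplies a first difference.\<close>
  have "?D \<noteq> {}" using PiE_ext[OF f g] \<open>f \<noteq> g\<close> by auto
  moreover have "wf (w - Id)" using w by (simp add: well_order_on_def)
  ultimately obtain x where x: "x \<in> ?D" "\<And>y. (y, x) \<in> w - Id \<Longrightarrow> y \<notin> ?D"
    unfolding wf_eq_minimal by (metis (no_types, lifting) all_not_in_conv)
  then have "(f x, g x) \<in> r \<or> (g x, f x) \<in> r"
    using linear_order_onD(5)[OF r, of "f x" "g x"] PiE_mem[OF f] PiE_mem[OF g] by auto
  moreover have "x \<in> X" "f x \<noteq> g x" "\<forall>y\<in>X. (y, x) \<in> w \<and> y \<noteq> x \<longrightarrow> f y = g y"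
    using x by auto
  ultimately show ?thesis unfolding lex_less_def by (metis (no_types, lifting))
qed

lemma linear_order_on_lex:
  assumes w: "well_order_on X w" and r: "linear_order_on B r" and F: "F \<subseteq> X \<rightarrow>\<^sub>E B"
  shows "linear_order_on F {(f, g). f \<in> F \<and> g \<in> F \<and> (f = g \<or> lex_less X w r f g)}"
proof (rule linear_order_onI, goal_cases)
  case (3 f g h)
  then show ?case using lex_less_trans[OF w r, of f g h] by auto
next
  case (4 f g)
  then show ?case using lex_less_trans[OF w r, of f g f] lex_less_irrefl[of X w r f] by auto
next
  case (5 f g)
  then show ?case using lex_less_total[OF w r, of f g] F by auto
qed auto

section \<open>Order automorphism groups and transfer of left invariant orders\<close>

lemma carrier_order_Aut:
  "carrier (order_Aut X r) = {h \<in> Bij X. \<forall>x\<in>X. \<forall>y\<in>X. (x, y) \<in> r \<longleftrightarrow> (h x, h y) \<in> r}"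
  by (simp add: order_Aut_def)

lemma carrier_order_Homeo:
  "carrier (order_Homeo K r) =
     {h \<in> Bij K. homeomorphic_map (interval_topology K r) (interval_topology K r) h \<and>
        (\<forall>x\<in>K. \<forall>y\<in>K. (x, y) \<in> r \<longrightarrow> (h x, h y) \<in> r)}"
  by (simp add: order_Homeo_def)

lemma mult_order_Aut:
  "g \<in> Bij X \<Longrightarrow> h \<in> Bij X \<Longrightarrow> g \<otimes>\<^bsub>order_Aut X r\<^esub> h = compose X g h"
  by (simp add: order_Aut_def BijGroup_def)

lemma mult_order_Homeo:
  "g \<in> Bij K \<Longrightarrow> h \<in> Bij K \<Longrightarrow> g \<otimes>\<^bsub>order_Homeo K r\<^esub> h = compose K g h"
  by (simp add: order_Homeo_def BijGroup_def)

lemma Bij_iff: "h \<in> Bij X \<longleftrightarrow> h \<in> X \<rightarrow>\<^sub>E X \<and> bij_betw h X X"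
  using bij_betw_imp_funcset[of h X X] by (simp add: Bij_def PiE_def) blast

lemma order_AutD:
  assumes "h \<in> carrier (order_Aut X r)"
  shows "h \<in> Bij X" "bij_betw h X X" "inj_on h X" "h ` X = X" "h \<in> X \<rightarrow>\<^sub>E X"
    and "x \<in> X \<Longrightarrow> h x \<in> X"
    and "x \<in> X \<Longrightarrow> y \<in> X \<Longrightarrow> (h x, h y) \<in> r \<longleftrightarrow> (x, y) \<in> r"
proof -
  show B: "h \<in> Bij X" using assms unfolding carrier_order_Aut by blast
  then show "bij_betw h X X" "h \<in> X \<rightarrow>\<^sub>E X" unfolding Bij_iff by blast+
  then show "inj_on h X" "h ` X = X" "x \<in> X \<Longrightarrow> h x \<in> X" unfolding bij_betw_def by auto
  show "x \<in> X \<Longrightarrow> y \<in> X \<Longrightarrow> (h x, h y) \<in> r \<longleftrightarrow> (x, y) \<in> r"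
    using assms unfolding carrier_order_Aut by blast
qed

lemma left_linearly_orderable_order_Aut:
  assumes r: "linear_order_on X r"
  shows "left_linearly_orderable (order_Aut X r)"
proof -
  let ?A = "carrier (order_Aut X r)"
  obtain w where w: "well_order_on X w" using well_order_on by blast
  let ?R = "{(f, g). f \<in> ?A \<and> g \<in> ?A \<and> (f = g \<or> lex_less X w r f g)}"
  note A = order_AutD(5,3,6,7)
  have comp: "k \<otimes>\<^bsub>order_Aut X r\<^esub> f = compose X k f" if "k \<in> ?A" "f \<in> ?A" for k f
    using order_AutD(1)[OF that(1)] order_AutD(1)[OF that(2)] by (rule mult_order_Aut)
  have closed: "compose X k f \<in> ?A" if "k \<in> ?A" "f \<in> ?A" for k f
    using compose_Bij[OF order_AutD(1)[OF that(1)] order_AutD(1)[OF that(2)]]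
      A(3)[OF that(2)] A(4)[OF that(1)] A(4)[OF that(2)]
    by (simp add: carrier_order_Aut compose_eq)
  have "linear_order_on ?A ?R"
    by (rule linear_order_on_lex[OF w r subsetI[OF A(1)]])
  moreover have "(f, g) \<in> ?R \<longleftrightarrow> (k \<otimes>\<^bsub>order_Aut X r\<^esub> f, k \<otimes>\<^bsub>order_Aut X r\<^esub> g) \<in> ?R"
    if k: "k \<in> ?A" and f: "f \<in> ?A" and g: "g \<in> ?A" for k f g
  proof -
    have eq: "k (f x) = k (g x) \<longleftrightarrow> f x = g x" if "x \<in> X" for x
      using A(2)[OF k] A(3)[OF f that] A(3)[OF g that] by (auto dest: inj_onD)
    \<comment> \<open>Composition with \<open>k\<close> acts on values and leaves the index alone:
      \<open>eq\<close> keeps the agreement before the deciding point, and \<open>A(4)\<close> keeps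
      the comparison at it.\<close>
    have "lex_less X w r (compose X k f) (compose X k g) \<longleftrightarrow> lex_less X w r f g"
      unfolding lex_less_def
      using eq A(3)[OF f] A(3)[OF g] A(4)[OF k] by (auto simp: compose_eq)
    moreover have "compose X k f = compose X k g \<longleftrightarrow> f = g"
      using eq PiE_ext[OF A(1)[OF f] A(1)[OF g]] by (metis compose_eq)
    ultimately show ?thesis
      using k f g closed by (simp add: comp)
  qed
  ultimately show ?thesis unfolding left_linearly_orderable_def
    by (intro exI[of _ ?R] conjI ballI)
qed

text \<open>A homomorphism carries left translations of \<open>G\<close> to left translations of
  \<open>H\<close>, so the order pulled back along it stays invariant; injectivity makes the
  pullback antisymmetric.\<close>

lemma left_linearly_orderable_mon:
  assumes G: "group G" and f: "f \<in> mon G H" and H: "left_linearly_orderable H"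
  shows "left_linearly_orderable G"
proof -
  interpret group G by fact
  have hom: "\<And>x. x \<in> carrier G \<Longrightarrow> f x \<in> carrier H"
    "\<And>x y. x \<in> carrier G \<Longrightarrow> y \<in> carrier G \<Longrightarrow> f (x \<otimes>\<^bsub>G\<^esub> y) = f x \<otimes>\<^bsub>H\<^esub> f y"
    and inj: "inj_on f (carrier G)"
    using f by (auto simp: mon_def hom_def)
  obtain r where r: "linear_order_on (carrier H) r"
    and inv: "\<And>g x y. g \<in> carrier H \<Longrightarrow> x \<in> carrier H \<Longrightarrow> y \<in> carrier H \<Longrightarrow>
             (x, y) \<in> r \<longleftrightarrow> (g \<otimes>\<^bsub>H\<^esub> x, g \<otimes>\<^bsub>H\<^esub> y) \<in> r"
    using H unfolding left_linearly_orderable_def by blast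
  let ?R = "{(x, y). x \<in> carrier G \<and> y \<in> carrier G \<and> (f x, f y) \<in> r}"
  have "linear_order_on (carrier G) ?R"
    using linear_order_on_pullback[OF r inj] hom(1) by blast
  moreover have "(x, y) \<in> ?R \<longleftrightarrow> (g \<otimes>\<^bsub>G\<^esub> x, g \<otimes>\<^bsub>G\<^esub> y) \<in> ?R"
    if "g \<in> carrier G" "x \<in> carrier G" "y \<in> carrier G" for g x y
    using that hom inv[of "f g" "f x" "f y"] by simp
  ultimately show ?thesis unfolding left_linearly_orderable_def by blast
qed

lemma embeds_in_some_order_Aut_imp_orderable:
  assumes "group G" "embeds_in_some_order_Aut TYPE('x) G"
  shows "left_linearly_orderable G"
proof -
  obtain X :: "'x set" and r f where "linear_order_on X r" "f \<in> mon G (order_Aut X r)"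
    using assms(2) unfolding embeds_in_some_order_Aut_def by blast
  then show ?thesis
    using left_linearly_orderable_mon[OF assms(1)] left_linearly_orderable_order_Aut by metis
qed

section \<open>From order-preserving homeomorphisms to orderability\<close>

text \<open>\<open>order_Homeo\<close> asks for monotonicity, \<open>order_Aut\<close> for an
  equivalence. In a linear order the gap closes: if \<open>x \<le> y\<close> fails, then
  \<open>y \<le> x\<close>, and \<open>h x \<le> h y\<close> would force \<open>h x = h y\<close>,
  hence \<open>x = y\<close>.\<close>

lemma order_Homeo_subset_order_Aut:
  assumes r: "linear_order_on K r"
  shows "carrier (order_Homeo K r) \<subseteq> carrier (order_Aut K r)"
proof
  fix h assume h: "h \<in> carrier (order_Homeo K r)"
  then have B: "h \<in> Bij K" and mono: "\<And>x y. x \<in> K \<Longrightarrow> y \<in> K \<Longrightarrow> (x, y) \<in> r \<Longrightarrow> (h x, h y) \<in> r"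
    by (auto simp: carrier_order_Homeo)
  have "(x, y) \<in> r" if "x \<in> K" "y \<in> K" "(h x, h y) \<in> r" for x y
  proof (rule ccontr)
    assume n: "(x, y) \<notin> r"
    then have "(y, x) \<in> r" using linear_order_onD(5)[OF r] that by blast
    then have "h x = h y" using mono that linear_order_onD(4)[OF r] by blast
    then have "x = y" using B that by (auto simp: Bij_def bij_betw_def dest: inj_onD)
    with n \<open>(y, x) \<in> r\<close> show False by simp
  qed
  with B mono show "h \<in> carrier (order_Aut K r)" unfolding carrier_order_Aut by blast
qed

text \<open>This is (2) \<Longrightarrow> (3) with \<open>K\<close> itself as the ordered set: the
  topological embedding is kept only for its injectivity, and both groups inherit their
  multiplication from \<open>BijGroup K\<close>.\<close>

lemma embeds_in_order_Homeo_imp_mon: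
  assumes r: "linear_order_on K r" and "embeds_in_order_Homeo G T K r"
  shows "\<exists>f. f \<in> mon G (order_Aut K r)"
proof -
  obtain f where T: "topspace T = carrier G" and f: "f \<in> hom G (order_Homeo K r)"
    and emb: "embedding_map T (order_Homeo_topology K r) f"
    using assms(2) unfolding embeds_in_order_Homeo_def by blast
  have "inj_on f (carrier G)"
    using emb T by (auto simp: embedding_map_def homeomorphic_eq_everything_map)
  moreover have "f \<in> hom G (order_Aut K r)"
    using f order_Homeo_subset_order_Aut[OF r]
    by (auto simp: hom_def order_Homeo_def order_Aut_def)
  ultimately show ?thesis by (auto simp: mon_def)
qed

lemma orderly_imp_orderable:
  assumes "group G" "orderly TYPE('k) G T"
  shows "left_linearly_orderable G"
proof -
  obtain K :: "'k set" and r where "linear_order_on K r" "embeds_in_order_Homeo G T K r"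
    using assms(2) unfolding orderly_def compact_linearly_ordered_space_def by blast
  then have "embeds_in_some_order_Aut TYPE('k) G"
    using embeds_in_order_Homeo_imp_mon unfolding embeds_in_some_order_Aut_def by blast
  then show ?thesis by (rule embeds_in_some_order_Aut_imp_orderable[OF assms(1)])
qed

text \<open>The left regular representation; it gives (1) \<Longrightarrow> (3) with
  \<open>G\<close> acting on itself.\<close>

lemma left_translation_mon:
  assumes G: "group G"
    and inv: "\<forall>g\<in>carrier G. \<forall>x\<in>carrier G. \<forall>y\<in>carrier G.
             (x, y) \<in> r \<longleftrightarrow> (g \<otimes>\<^bsub>G\<^esub> x, g \<otimes>\<^bsub>G\<^esub> y) \<in> r"
  shows "(\<lambda>g. \<lambda>x\<in>carrier G. g \<otimes>\<^bsub>G\<^esub> x) \<in> mon G (order_Aut (carrier G) r)"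
proof -
  interpret group G by fact
  have bij: "(\<lambda>x\<in>carrier G. g \<otimes>\<^bsub>G\<^esub> x) \<in> Bij (carrier G)" if "g \<in> carrier G" for g
    using that surj_const_mult[OF that] inj_on_cmult[OF that]
    by (simp add: Bij_def bij_betw_def inj_on_def)
  \<comment> \<open>A translation determines \<open>g\<close> as its value at the unit.\<close>
  have "inj_on (\<lambda>g. \<lambda>x\<in>carrier G. g \<otimes>\<^bsub>G\<^esub> x) (carrier G)"
    by (rule inj_onI) (metis one_closed r_one restrict_apply')
  moreover have "(\<lambda>x\<in>carrier G. g \<otimes>\<^bsub>G\<^esub> x) \<in> carrier (order_Aut (carrier G) r)"
    if "g \<in> carrier G" for g
    using bij[OF that] inv[rule_format, OF that, symmetric] by (simp add: carrier_order_Aut)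
  moreover have "(\<lambda>x\<in>carrier G. g \<otimes>\<^bsub>G\<^esub> h \<otimes>\<^bsub>G\<^esub> x) =
      (\<lambda>x\<in>carrier G. g \<otimes>\<^bsub>G\<^esub> x) \<otimes>\<^bsub>order_Aut (carrier G) r\<^esub> (\<lambda>x\<in>carrier G. h \<otimes>\<^bsub>G\<^esub> x)"
    if "g \<in> carrier G" "h \<in> carrier G" for g h
    using bij that by (auto simp: mult_order_Aut compose_def m_assoc restrict_def)
  ultimately show ?thesis by (auto simp: mon_def hom_def)
qed

section \<open>The space of initial segments\<close>

lemma openin_interval_topology_ray:
  assumes "a \<in> X"
  shows "openin (interval_topology X r) {x \<in> X. (a, x) \<in> r \<and> x \<noteq> a}"
    and "openin (interval_topology X r) {x \<in> X. (x, a) \<in> r \<and> x \<noteq> a}"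
  using assms unfolding interval_topology_def
  by (intro topology_generated_by_Basis; blast)+

lemma continuous_map_order_iso:
  assumes f: "bij_betw f X Y"
    and iso: "\<And>x y. x \<in> X \<Longrightarrow> y \<in> X \<Longrightarrow> (x, y) \<in> r \<longleftrightarrow> (f x, f y) \<in> s"
  shows "continuous_map (interval_topology X r) (interval_topology Y s) f"
proof -
  have ray: "f -` {y \<in> Y. (f a, y) \<in> s \<and> y \<noteq> f a} \<inter> X = {x \<in> X. (a, x) \<in> r \<and> x \<noteq> a}"
      "f -` {y \<in> Y. (y, f a) \<in> s \<and> y \<noteq> f a} \<inter> X = {x \<in> X. (x, a) \<in> r \<and> x \<noteq> a}"
    if "a \<in> X" for a
    using that iso f by (auto simp: bij_betw_def inj_on_def)
  \<comment> \<open>Every endpoint of a ray in \<open>Y\<close> has the form \<open>f a\<close>, so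
    each subbasic preimage is the ray at \<open>a\<close> on the same side, or all of
    \<open>X\<close>.\<close>
  have surj: "Y = f ` X" using f by (simp add: bij_betw_def)
  have X: "f -` Y \<inter> X = X" using surj by auto
  show ?thesis
    unfolding interval_topology_def[of Y]
  proof (rule continuous_on_generated_topo)
    fix U
    assume "U \<in> insert Y ({{x \<in> Y. (a, x) \<in> s \<and> x \<noteq> a} |a. a \<in> Y} \<union>
                  {{x \<in> Y. (x, b) \<in> s \<and> x \<noteq> b} |b. b \<in> Y})"
    then consider "U = Y" | a where "a \<in> X" "U = {y \<in> Y. (f a, y) \<in> s \<and> y \<noteq> f a}"
      | a where "a \<in> X" "U = {y \<in> Y. (y, f a) \<in> s \<and> y \<noteq> f a}"
      using surj by blast
    then show "openin (interval_topology X r) (f -` U \<inter> topspace (interval_topology X r))"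
      by cases (use ray X openin_interval_topology_ray[of _ X r] openin_topspace[of "interval_topology X r"] in auto)
  qed (use surj in auto)
qed

text \<open>The inverse of an order isomorphism is again one, so
  \<open>continuous_map_order_iso\<close> applies in both directions. This later places the action
  on segments inside \<open>order_Homeo\<close>.\<close>

lemma homeomorphic_map_order_iso:
  assumes f: "bij_betw f X Y"
    and iso: "\<And>x y. x \<in> X \<Longrightarrow> y \<in> X \<Longrightarrow> (x, y) \<in> r \<longleftrightarrow> (f x, f y) \<in> s"
  shows "homeomorphic_map (interval_topology X r) (interval_topology Y s) f"
proof -
  let ?g = "inv_into X f"
  have g: "bij_betw ?g Y X" using f by (rule bij_betw_inv_into)
  have "(x, y) \<in> s \<longleftrightarrow> (?g x, ?g y) \<in> r" if "x \<in> Y" "y \<in> Y" for x y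
    using that iso[of "?g x" "?g y"] f g
    by (simp add: bij_betw_apply bij_betw_inv_into_right)
  then have "homeomorphic_maps (interval_topology X r) (interval_topology Y s) f ?g"
    using continuous_map_order_iso[of f X Y r s] continuous_map_order_iso[of ?g Y X s r] assms g
    by (simp add: homeomorphic_maps_def bij_betw_inv_into_left bij_betw_inv_into_right)
  then show ?thesis by (rule homeomorphic_maps_imp_map)
qed

section \<open>Compactness of chains of sets closed under unions\<close>

text \<open>\<open>Alexander_subbase\<close> speaks of unions of finite intersections relative to
  \<open>\<Union>\<B>\<close>, whereas the interval topology is a
  \<open>topology_generated_by\<close>. Each of the two topologies contains the subbase and is
  minimal with that property, so they coincide.\<close>

lemma Alexander_subbase_generated:
  assumes "\<And>\<C>. \<C> \<subseteq> \<B> \<Longrightarrow> \<Union>\<C> = \<Union>\<B> \<Longrightarrow> \<exists>\<F>. finite \<F> \<and> \<F> \<subseteq> \<C> \<and> \<Union>\<F> = \<Union>\<B>"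
  shows "compact_space (topology_generated_by \<B>)"
proof (rule Alexander_subbase)
  let ?T = "topology (arbitrary union_of (finite intersection_of (\<lambda>x. x \<in> \<B>) relative_to \<Union>\<B>))"
  have op: "openin ?T S \<longleftrightarrow>
      (arbitrary union_of (finite intersection_of (\<lambda>x. x \<in> \<B>) relative_to \<Union>\<B>)) S" for S
    by (rule openin_subbase)
  show "?T = topology_generated_by \<B>"
    unfolding topology_eq
  proof (intro allI iffI)
    fix S assume "openin (topology_generated_by \<B>) S"
    then have "generate_topology_on \<B> S" by (rule openin_topology_generated_by)
    then show "openin ?T S"
    proof (rule generate_topology_on_coarsest[rotated 2])
      fix U assume U: "U \<in> \<B>"
      then have "(finite intersection_of (\<lambda>x. x \<in> \<B>) relative_to \<Union>\<B>) (\<Union>\<B> \<inter> U)"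
        by (intro relative_to_inc finite_intersection_of_inc)
      moreover have "\<Union>\<B> \<inter> U = U" using U by blast
      ultimately show "openin ?T U" unfolding op by (simp add: arbitrary_union_of_inc)
    qed simp
  next
    fix S assume "openin ?T S"
    then show "openin (topology_generated_by \<B>) S"
      by (rule minimal_topology_subbase[rotated 2])
        (auto intro: topology_generated_by_Basis openin_topspace[of "topology_generated_by \<B>", simplified])
  qed
qed (use assms in simp)

definition inclusion_order :: "'c set set \<Rightarrow> 'c set rel" where
  "inclusion_order K = {(I, J). I \<in> K \<and> J \<in> K \<and> I \<subseteq> J}"

lemma inclusion_order_iff [simp]: "(I, J) \<in> inclusion_order K \<longleftrightarrow> I \<in> K \<and> J \<in> K \<and> I \<subseteq> J"
  by (simp add: inclusion_order_def)

lemma linear_order_on_inclusion_order: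
  assumes "\<And>I J. I \<in> K \<Longrightarrow> J \<in> K \<Longrightarrow> I \<subseteq> J \<or> J \<subseteq> I"
  shows "linear_order_on K (inclusion_order K)"
proof (rule linear_order_onI, goal_cases)
  case (5 I J)
  then show ?case using assms[of I J] by simp
qed auto

text \<open>By the subbase theorem only covers by rays and \<open>K\<close> matter. Closure under
  unions provides suprema, and looking at which member covers one well-chosen supremum leaves a
  subcover of at most two sets.\<close>

lemma compact_space_inclusion_order:
  assumes chain: "\<And>I J. I \<in> K \<Longrightarrow> J \<in> K \<Longrightarrow> I \<subseteq> J \<or> J \<subseteq> I"
    and Un: "\<And>\<J>. \<J> \<subseteq> K \<Longrightarrow> \<Union>\<J> \<in> K"
  shows "compact_space (interval_topology K (inclusion_order K))"
proof -
  define up where "up a = {I \<in> K. a \<subset> I}" for a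
  define dn where "dn b = {I \<in> K. I \<subset> b}" for b
  have up: "{I \<in> K. (a, I) \<in> inclusion_order K \<and> I \<noteq> a} = up a" if "a \<in> K" for a
    using that by (auto simp: up_def)
  have dn: "{I \<in> K. (I, b) \<in> inclusion_order K \<and> I \<noteq> b} = dn b" if "b \<in> K" for b
    using that by (auto simp: dn_def)
  define \<B> where "\<B> = insert K (up ` K \<union> dn ` K)"
  have "{{I \<in> K. (a, I) \<in> inclusion_order K \<and> I \<noteq> a} |a. a \<in> K} = up ` K"
    unfolding Setcompr_eq_image by (rule image_cong[OF refl up])
  moreover have "{{I \<in> K. (I, b) \<in> inclusion_order K \<and> I \<noteq> b} |b. b \<in> K} = dn ` K"
    unfolding Setcompr_eq_image by (rule image_cong[OF refl dn])
  ultimately have top: "interval_topology K (inclusion_order K) = topology_generated_by \<B>"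
    unfolding interval_topology_def \<B>_def by (simp only:)
  have UB: "\<Union>\<B> = K" by (auto simp: \<B>_def up_def dn_def)
  show ?thesis
    unfolding top
  proof (rule Alexander_subbase_generated)
    fix \<C> assume \<C>: "\<C> \<subseteq> \<B>" "\<Union>\<C> = \<Union>\<B>"
    \<comment> \<open>The endpoints of all downward rays in the cover. Their supremum
      \<open>\<Union>L\<close> is a point of \<open>K\<close>, also for empty \<open>L\<close>, and
      no downward ray of the cover reaches it.\<close>
    define L where "L = {b \<in> K. dn b \<in> \<C>}"
    have sK: "\<Union>L \<in> K" using Un by (auto simp: L_def)
    then obtain U where U: "U \<in> \<C>" "\<Union>L \<in> U" using \<C>(2) UB by blast
    have "U \<noteq> dn b" if "b \<in> K" for b
    proof
      assume "U = dn b"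
      then have "b \<in> L" "\<Union>L \<subset> b" using that U by (auto simp: L_def dn_def)
      then show False by blast
    qed
    then consider "U = K" | a where "a \<in> K" "U = up a" using U(1) \<C>(1) unfolding \<B>_def by blast
    then show "\<exists>\<F>. finite \<F> \<and> \<F> \<subseteq> \<C> \<and> \<Union>\<F> = \<Union>\<B>"
    proof cases
      case 1
      then show ?thesis using U(1) UB by (intro exI[of _ "{U}"]) auto
    next
      case 2
      then have "a \<subset> \<Union>L" using U(2) by (auto simp: up_def)
      then obtain b where b: "b \<in> L" "\<not> b \<subseteq> a" by blast
      then have "a \<subset> b" using chain[of a b] 2(1) by (auto simp: L_def)
      \<comment> \<open>A segment not strictly below \<open>b\<close> contains \<open>b\<close>,
        hence lies strictly above \<open>a\<close>.\<close>
      then have "up a \<union> dn b = K"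
        using chain b(1) 2(1) unfolding up_def dn_def L_def by blast
      then show ?thesis using U(1) b(1) 2(2) UB
        by (intro exI[of _ "{up a, dn b}"]) (auto simp: L_def)
    qed
  qed
qed

section \<open>Covering dimension zero\<close>

text \<open>Compactness and the clopen base refine an open cover by finitely many clopen sets, which
  are then cut into disjoint pieces. Nonemptiness excludes dimension -1, where every multiplicity
  would have to be 0.\<close>

lemma has_covering_dim_0:
  assumes comp: "compact_space X" and ne: "topspace X \<noteq> {}"
    and base: "\<And>x U. openin X U \<Longrightarrow> x \<in> U \<Longrightarrow> \<exists>W. openin X W \<and> closedin X W \<and> x \<in> W \<and> W \<subseteq> U"
  shows "has_covering_dim X 0"
  unfolding has_covering_dim_def
proof
  show "\<not> covering_dim_le X (0 - 1)"
  proof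
    assume "covering_dim_le X (0 - 1)"
    then obtain \<V> where \<V>: "finite \<V>" "\<Union>\<V> = topspace X"
      "\<And>x. x \<in> topspace X \<Longrightarrow> int (card {V \<in> \<V>. x \<in> V}) \<le> 0"
      unfolding covering_dim_le_def by (auto dest!: spec[of _ "{topspace X}"])
    obtain x where x: "x \<in> topspace X" using ne by blast
    then have "{V \<in> \<V>. x \<in> V} \<noteq> {}" using \<V>(2) by blast
    then have "card {V \<in> \<V>. x \<in> V} > 0"
      unfolding card_gt_0_iff using \<V>(1) by (intro conjI) auto
    then show False using \<V>(3)[OF x] by linarith
  qed
  show "covering_dim_le X 0"
    unfolding covering_dim_le_def
  proof (intro conjI allI impI)
    fix \<U> assume \<U>: "finite \<U> \<and> (\<forall>U\<in>\<U>. openin X U) \<and> \<Union>\<U> = topspace X"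
    let ?W = "{W. openin X W \<and> closedin X W \<and> (\<exists>U\<in>\<U>. W \<subseteq> U)}"
    have "topspace X \<subseteq> \<Union>?W"
    proof
      fix x assume "x \<in> topspace X"
      then obtain U where "U \<in> \<U>" "x \<in> U" using \<U> by blast
      then show "x \<in> \<Union>?W" using base[of U x] \<U> by blast
    qed
    then obtain \<W> where \<W>: "finite \<W>" "\<W> \<subseteq> ?W" "topspace X \<subseteq> \<Union>\<W>"
      using comp unfolding compact_space_alt
      by (metis (no_types, lifting) mem_Collect_eq)
    \<comment> \<open>The atoms of the Boolean algebra generated by \<open>\<W>\<close> are a disjoint refinement.\<close>
    define atom where "atom S = topspace X \<inter> \<Inter>((\<lambda>W. if W \<in> S then W else topspace X - W) ` \<W>)" for S
    let ?V = "(\<lambda>x. atom {W \<in> \<W>. x \<in> W}) ` topspace X"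
    \<comment> \<open>An atom consists of the points with one fixed membership pattern, so each
      point lies in exactly one atom of \<open>?V\<close>.\<close>
    have mem: "y \<in> atom {W \<in> \<W>. x \<in> W} \<longleftrightarrow> y \<in> topspace X \<and> {W \<in> \<W>. y \<in> W} = {W \<in> \<W>. x \<in> W}"
      for x y by (auto simp: atom_def split: if_splits)
    have "?V \<subseteq> atom ` Pow \<W>" by auto
    then have fin: "finite ?V" using \<W>(1) by (meson finite_Pow_iff finite_imageI finite_subset)
    show "\<exists>\<V>. finite \<V> \<and> (\<forall>V\<in>\<V>. openin X V) \<and> \<Union>\<V> = topspace X \<and>
             (\<forall>V\<in>\<V>. \<exists>U\<in>\<U>. V \<subseteq> U) \<and>
             (\<forall>x\<in>topspace X. int (card {V \<in> \<V>. x \<in> V}) \<le> 0 + 1)"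
    proof (intro exI[of _ ?V] conjI ballI fin)
      fix V assume "V \<in> ?V"
      then obtain x where x: "x \<in> topspace X" "V = atom {W \<in> \<W>. x \<in> W}" by blast
      have "openin X (topspace X \<inter> \<Inter>((\<lambda>W. if W \<in> {W \<in> \<W>. x \<in> W} then W else topspace X - W) ` \<W>))"
        using \<W>(1,2) by (intro openin_Int_Inter) (auto simp: openin_diff)
      then show "openin X V" using x(2) by (simp add: atom_def)
      obtain W where W: "W \<in> \<W>" "x \<in> W" using x(1) \<W>(3) by blast
      then have "V \<subseteq> W" using x(2) mem by blast
      moreover obtain U where "U \<in> \<U>" "W \<subseteq> U" using W(1) \<W>(2) by blast
      ultimately show "\<exists>U\<in>\<U>. V \<subseteq> U" by blast
    next
      show "\<Union>?V = topspace X" using mem by blast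
    next
      fix x assume x: "x \<in> topspace X"
      have "{V \<in> ?V. x \<in> V} \<subseteq> {atom {W \<in> \<W>. x \<in> W}}"
        using mem by auto
      then have "card {V \<in> ?V. x \<in> V} \<le> card {atom {W \<in> \<W>. x \<in> W}}"
        by (rule card_mono[rotated]) simp
      then show "int (card {V \<in> ?V. x \<in> V}) \<le> 0 + 1" by simp
    qed
  qed simp
qed

text \<open>Singletons are compact, so conditions on the value at one point are already subbasic in
  the compact-open topology.\<close>

lemma openin_order_Homeo_point:
  assumes "x \<in> K" "openin (interval_topology K s) U"
  shows "openin (order_Homeo_topology K s) {f \<in> carrier (order_Homeo K s). f x \<in> U}"
proof -
  let ?T = "interval_topology K s"
  let ?S = "{f \<in> topspace ?T \<rightarrow>\<^sub>E topspace ?T. continuous_map ?T ?T f \<and> f ` {x} \<subseteq> U}"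
  have "compactin ?T {x}" using assms(1) by simp
  then have "openin (compact_open_topology ?T ?T) ?S"
    unfolding compact_open_topology_def
    using assms(2) by (intro topology_generated_by_Basis) blast
  moreover have "{f \<in> carrier (order_Homeo K s). f x \<in> U} = ?S \<inter> carrier (order_Homeo K s)"
    by (auto simp: carrier_order_Homeo Bij_iff homeomorphic_imp_continuous_map)
  ultimately show ?thesis
    unfolding order_Homeo_topology_def openin_subtopology by blast
qed

section \<open>Initial segments as a compact zero-dimensional space\<close>

text \<open>All cuts are kept, including the empty one and \<open>X\<close>, so that every
  \<open>x\<close> yields two adjacent points of the space, one without \<open>x\<close> and one
  with it.\<close>

definition initial_segments :: "'b set \<Rightarrow> 'b rel \<Rightarrow> 'b set set" where
  "initial_segments X r = {I. I \<subseteq> X \<and> (\<forall>x\<in>I. \<forall>y. (y, x) \<in> r \<longrightarrow> y \<in> I)}"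

abbreviation segment_space :: "'b set \<Rightarrow> 'b rel \<Rightarrow> 'b set topology" where
  "segment_space X r \<equiv>
     interval_topology (initial_segments X r) (inclusion_order (initial_segments X r))"

context
  fixes X :: "'b set" and r :: "'b rel"
  assumes r: "linear_order_on X r"
begin

lemma initial_segments_chain:
  assumes "I \<in> initial_segments X r" "J \<in> initial_segments X r"
  shows "I \<subseteq> J \<or> J \<subseteq> I"
proof (rule ccontr)
  assume "\<not> (I \<subseteq> J \<or> J \<subseteq> I)"
  then obtain x y where "x \<in> I" "x \<notin> J" "y \<in> J" "y \<notin> I" by blast
  moreover from this have "(x, y) \<in> r \<or> (y, x) \<in> r"
    using assms linear_order_onD(5)[OF r, of x y] by (auto simp: initial_segments_def)
  ultimately show False using assms by (auto simp: initial_segments_def)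
qed

lemma compact_segment_space:
  "compact_linearly_ordered_space (initial_segments X r) (inclusion_order (initial_segments X r))"
  unfolding compact_linearly_ordered_space_def
proof (intro conjI linear_order_on_inclusion_order compact_space_inclusion_order)
  show "\<Union>\<J> \<in> initial_segments X r" if "\<J> \<subseteq> initial_segments X r" for \<J>
    using that unfolding initial_segments_def by blast
qed (fact initial_segments_chain)+

lemma principal_segments:
  assumes "x \<in> X"
  shows "{y \<in> X. (y, x) \<in> r} \<in> initial_segments X r"
    and "{y \<in> X. (y, x) \<in> r \<and> y \<noteq> x} \<in> initial_segments X r"
  using linear_order_onD(1)[OF r] linear_order_onD(3,4)[OF r]
  unfolding initial_segments_def by blast+

text \<open>Nothing lies strictly between the ends \<open>?s\<close> and \<open>?l\<close> of the
  jump at \<open>x\<close>: a segment contains \<open>x\<close> exactly when it is strictly above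
  \<open>?s\<close>, and omits \<open>x\<close> exactly when it is strictly below \<open>?l\<close>.
  Both sets are therefore rays.\<close>

lemma openin_segments_containing:
  assumes x: "x \<in> X"
  shows "openin (segment_space X r) {I \<in> initial_segments X r. x \<in> I}"
    and "openin (segment_space X r) {I \<in> initial_segments X r. x \<notin> I}"
proof -
  let ?K = "initial_segments X r"
  let ?l = "{y \<in> X. (y, x) \<in> r}" and ?s = "{y \<in> X. (y, x) \<in> r \<and> y \<noteq> x}"
  note K = principal_segments[OF x]
  have above: "?l \<subseteq> I" if "I \<in> ?K" "x \<in> I" for I
    using that by (auto simp: initial_segments_def)
  have below: "I \<subseteq> ?s" if "I \<in> ?K" "x \<notin> I" for I
  proof
    fix y assume "y \<in> I"
    with that show "y \<in> ?s"
      using x linear_order_onD(5)[OF r, of x y] by (auto simp: initial_segments_def)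
  qed
  have x_l: "x \<in> ?l" using x linear_order_onD(2)[OF r x] by simp
  have "(?s, I) \<in> inclusion_order ?K \<and> I \<noteq> ?s \<longleftrightarrow> x \<in> I" if "I \<in> ?K" for I
  proof (cases "x \<in> I")
    case True
    then have "?s \<subseteq> I" "I \<noteq> ?s" using above[OF that] by auto
    then show ?thesis using True that K by simp
  next
    case False
    then show ?thesis using below[OF that] by auto
  qed
  then have "{I \<in> ?K. (?s, I) \<in> inclusion_order ?K \<and> I \<noteq> ?s} = {I \<in> ?K. x \<in> I}"
    by (intro Collect_cong) auto
  then show "openin (segment_space X r) {I \<in> ?K. x \<in> I}"
    using openin_interval_topology_ray(1)[OF K(2), of "inclusion_order ?K"] by (simp only:)
  have "(I, ?l) \<in> inclusion_order ?K \<and> I \<noteq> ?l \<longleftrightarrow> x \<notin> I" if "I \<in> ?K" for I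
  proof (cases "x \<in> I")
    case True
    then show ?thesis using above[OF that] by auto
  next
    case False
    then have "I \<subseteq> ?l" "I \<noteq> ?l" using below[OF that] x_l by blast+
    then show ?thesis using False that K by simp
  qed
  then have "{I \<in> ?K. (I, ?l) \<in> inclusion_order ?K \<and> I \<noteq> ?l} = {I \<in> ?K. x \<notin> I}"
    by (intro Collect_cong) auto
  then show "openin (segment_space X r) {I \<in> ?K. x \<notin> I}"
    using openin_interval_topology_ray(2)[OF K(1), of "inclusion_order ?K"] by (simp only:)
qed

lemma clopen_segments_containing:
  assumes x: "x \<in> X"
  defines "T \<equiv> segment_space X r"
  shows "openin T {I \<in> initial_segments X r. x \<in> I} \<and> closedin T {I \<in> initial_segments X r. x \<in> I}"
    and "openin T {I \<in> initial_segments X r. x \<notin> I} \<and> closedin T {I \<in> initial_segments X r. x \<notin> I}"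
proof -
  let ?K = "initial_segments X r"
  have "?K - {I \<in> ?K. x \<in> I} = {I \<in> ?K. x \<notin> I}" "?K - {I \<in> ?K. x \<notin> I} = {I \<in> ?K. x \<in> I}"
    by auto
  then show "openin T {I \<in> ?K. x \<in> I} \<and> closedin T {I \<in> ?K. x \<in> I}"
    and "openin T {I \<in> ?K. x \<notin> I} \<and> closedin T {I \<in> ?K. x \<notin> I}"
    using openin_segments_containing[OF x] by (auto simp: closedin_def T_def)
qed

text \<open>Induction on the generation of \<open>U\<close>; the content is in the rays, where an
  element of \<open>X\<close> separating \<open>I\<close> from the endpoint cuts out the clopen
  neighbourhood.\<close>

lemma segment_space_clopen_base:
  assumes "openin (segment_space X r) U" "I \<in> U"
  shows "\<exists>W. openin (segment_space X r) W \<and> closedin (segment_space X r) W \<and> I \<in> W \<and> W \<subseteq> U"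
proof -
  let ?K = "initial_segments X r" and ?T = "segment_space X r"
  have "generate_topology_on (insert ?K
      ({{x \<in> ?K. (a, x) \<in> inclusion_order ?K \<and> x \<noteq> a} |a. a \<in> ?K} \<union>
       {{x \<in> ?K. (x, b) \<in> inclusion_order ?K \<and> x \<noteq> b} |b. b \<in> ?K})) U"
    using assms(1) unfolding interval_topology_def by (rule openin_topology_generated_by)
  then show ?thesis using \<open>I \<in> U\<close>
  proof (induction arbitrary: I)
    case Empty
    then show ?case by simp
  next
    case (Int A B)
    then obtain V W where "openin ?T V" "closedin ?T V" "I \<in> V" "V \<subseteq> A"
      "openin ?T W" "closedin ?T W" "I \<in> W" "W \<subseteq> B"
      by (meson IntD1 IntD2)
    then show ?case by (intro exI[of _ "V \<inter> W"]) auto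
  next
    case (UN \<A>)
    then obtain A where A: "A \<in> \<A>" "I \<in> A" by blast
    then show ?case using UN.IH[OF A] by blast
  next
    case (Basis S)
    then consider "S = ?K"
      | J where "J \<in> ?K" "S = {x \<in> ?K. (J, x) \<in> inclusion_order ?K \<and> x \<noteq> J}"
      | J where "J \<in> ?K" "S = {x \<in> ?K. (x, J) \<in> inclusion_order ?K \<and> x \<noteq> J}"
      by blast
    then show ?case
    proof cases
      case 1
      then show ?thesis
        using Basis.prems openin_topspace[of ?T] closedin_topspace[of ?T]
        by (intro exI[of _ ?K]) simp
    next
      case 2
      then have I: "I \<in> ?K" "J \<subseteq> I" "I \<noteq> J" using Basis.prems by auto
      \<comment> \<open>A segment containing \<open>x\<close> is not inside \<open>J\<close>, so by
        the chain property it lies strictly above \<open>J\<close>. The downward ray is treated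
        dually.\<close>
      then obtain x where x: "x \<in> I" "x \<notin> J" by blast
      have "x \<in> X" using x I(1) by (auto simp: initial_segments_def)
      moreover have "{I \<in> ?K. x \<in> I} \<subseteq> S"
        using 2 x(2) initial_segments_chain by auto
      ultimately show ?thesis
        using clopen_segments_containing(1) I(1) x(1) by (intro exI[of _ "{I \<in> ?K. x \<in> I}"]) simp
    next
      case 3
      then have I: "I \<in> ?K" "I \<subseteq> J" "I \<noteq> J" using Basis.prems by auto
      then obtain x where x: "x \<in> J" "x \<notin> I" by blast
      have "x \<in> X" using x 3(1) by (auto simp: initial_segments_def)
      moreover have "{I \<in> ?K. x \<notin> I} \<subseteq> S"
        using 3 x(1) initial_segments_chain by auto
      ultimately show ?thesis
        using clopen_segments_containing(2) I(1) x(2) by (intro exI[of _ "{I \<in> ?K. x \<notin> I}"]) simp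
    qed
  qed
qed

lemma has_covering_dim_segment_space: "has_covering_dim (segment_space X r) 0"
proof (rule has_covering_dim_0)
  \<comment> \<open>The empty segment makes the space nonempty even for empty
    \<open>X\<close>.\<close>
  have "{} \<in> initial_segments X r" by (simp add: initial_segments_def)
  then show "topspace (segment_space X r) \<noteq> {}" by auto
qed (use compact_segment_space segment_space_clopen_base
      in \<open>auto simp: compact_linearly_ordered_space_def\<close>)

section \<open>The action of automorphisms on initial segments\<close>

definition segment_action :: "('b \<Rightarrow> 'b) \<Rightarrow> 'b set \<Rightarrow> 'b set" where
  "segment_action h = (\<lambda>I\<in>initial_segments X r. h ` I)"

lemma image_initial_segment:
  assumes h: "h \<in> carrier (order_Aut X r)" and I: "I \<in> initial_segments X r"
  shows "h ` I \<in> initial_segments X r"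
  unfolding initial_segments_def
proof (intro CollectI conjI ballI allI impI)
  note surj = order_AutD(4)[OF h]
  then show "h ` I \<subseteq> X" using I by (auto simp: initial_segments_def)
  fix z y assume z: "z \<in> h ` I" and y: "(y, z) \<in> r"
  then obtain x where x: "x \<in> I" "z = h x" by blast
  \<comment> \<open>Downward closure of the image needs surjectivity to find \<open>y'\<close> and
    reflection of the order to put it below \<open>x\<close>.\<close>
  obtain y' where y': "y' \<in> X" "y = h y'" using y linear_order_onD(1)[OF r] surj by blast
  have "(y', x) \<in> r"
    using order_AutD(7)[OF h, of y' x] x y y' I by (auto simp: initial_segments_def)
  then show "y \<in> h ` I" using I x y' by (auto simp: initial_segments_def)
qed

lemma segment_action_Bij:
  assumes h: "h \<in> carrier (order_Aut X r)"
  shows "segment_action h \<in> Bij (initial_segments X r)"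
proof -
  let ?K = "initial_segments X r"
  note B = order_AutD(2)[OF h]
  have sub: "I \<subseteq> X" if "I \<in> ?K" for I using that by (simp add: initial_segments_def)
  \<comment> \<open>The inverse automorphism, restricted so as to be extensional; its image of a
    segment \<open>J\<close> is the segment that \<open>h\<close> sends onto
    \<open>J\<close>.\<close>
  let ?g = "\<lambda>x\<in>X. inv_into X h x"
  have g: "?g \<in> carrier (order_Aut X r)"
    using restrict_inv_into_Bij[OF order_AutD(1)[OF h]]
      order_AutD(7)[OF h Bij_inv_into_mem[OF order_AutD(1)[OF h]]
        Bij_inv_into_mem[OF order_AutD(1)[OF h]], symmetric]
    by (simp add: carrier_order_Aut bij_betw_inv_into_right[OF B])
  have inv: "h ` ?g ` J = J" if "J \<in> ?K" for J
  proof -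
    have "h (?g x) = x" if "x \<in> J" for x
      using that sub[OF \<open>J \<in> ?K\<close>] B by (auto simp: bij_betw_inv_into_right)
    then have "(\<lambda>x. h (?g x)) ` J = (\<lambda>x. x) ` J" by (rule image_cong[OF refl])
    then show ?thesis by (simp only: image_image image_ident)
  qed
  have "J \<in> (`) h ` ?K" if "J \<in> ?K" for J
    using inv[OF that] image_initial_segment[OF g that] by (metis imageI)
  then have "(`) h ` ?K = ?K" using image_initial_segment[OF h] by auto
  moreover have "inj_on ((`) h) ?K"
    using B sub by (auto simp: inj_on_def bij_betw_def inj_on_image_eq_iff)
  ultimately show ?thesis
    by (simp add: segment_action_def Bij_def bij_betw_def cong: inj_on_cong)
qed

text \<open>Since \<open>h\<close> is injective, taking images preserves and reflects inclusion; the
  action is thus by order isomorphisms, which are homeomorphisms for the interval topology.\<close>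

lemma segment_action_hom:
  "segment_action \<in> hom (order_Aut X r)
     (order_Homeo (initial_segments X r) (inclusion_order (initial_segments X r)))"
proof (rule homI)
  let ?K = "initial_segments X r" and ?A = "carrier (order_Aut X r)"
  fix h assume h: "h \<in> ?A"
  note inj = order_AutD(3)[OF h]
  note B = segment_action_Bij[OF h]
  have iso: "(I, J) \<in> inclusion_order ?K \<longleftrightarrow>
      (segment_action h I, segment_action h J) \<in> inclusion_order ?K"
    if "I \<in> ?K" "J \<in> ?K" for I J
  proof -
    have "I \<subseteq> X" "J \<subseteq> X" using that by (auto simp: initial_segments_def)
    then have "h ` I \<subseteq> h ` J \<longleftrightarrow> I \<subseteq> J" using inj by (simp add: inj_on_image_subset_iff)
    then show ?thesis using that image_initial_segment[OF h] by (simp add: segment_action_def)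
  qed
  have "homeomorphic_map (segment_space X r) (segment_space X r) (segment_action h)"
    by (rule homeomorphic_map_order_iso) (use B iso in \<open>auto simp: Bij_def\<close>)
  then show "segment_action h \<in> carrier (order_Homeo ?K (inclusion_order ?K))"
    unfolding carrier_order_Homeo using B iso by blast
next
  let ?K = "initial_segments X r" and ?A = "carrier (order_Aut X r)"
  fix g h assume g: "g \<in> ?A" and h: "h \<in> ?A"
  have m: "g \<otimes>\<^bsub>order_Aut X r\<^esub> h = compose X g h"
    using order_AutD(1)[OF g] order_AutD(1)[OF h] by (rule mult_order_Aut)
  have comp: "compose X g h ` I = g ` h ` I" if "I \<in> ?K" for I
  proof -
    have "I \<subseteq> X" using that by (simp add: initial_segments_def)
    then show ?thesis unfolding image_image by (intro image_cong) (auto simp: compose_eq)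
  qed
  show "segment_action (g \<otimes>\<^bsub>order_Aut X r\<^esub> h) =
      segment_action g \<otimes>\<^bsub>order_Homeo ?K (inclusion_order ?K)\<^esub> segment_action h"
    unfolding m mult_order_Homeo[OF segment_action_Bij[OF g] segment_action_Bij[OF h]]
    unfolding segment_action_def compose_def[of ?K]
    by (rule restrict_ext) (simp add: comp image_initial_segment[OF h])
qed

text \<open>Whether \<open>h e = a\<close> is read off from where the jump at \<open>e\<close> is sent.\<close>
lemma openin_segment_action_eq:
  assumes e: "e \<in> X" and a: "a \<in> X"
  obtains W where
    "openin (order_Homeo_topology (initial_segments X r) (inclusion_order (initial_segments X r))) W"
    "\<And>h. h \<in> carrier (order_Aut X r) \<Longrightarrow> segment_action h \<in> W \<longleftrightarrow> h e = a"
proof -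
  let ?K = "initial_segments X r"
  let ?H = "carrier (order_Homeo ?K (inclusion_order ?K))"
  let ?l = "{y \<in> X. (y, e) \<in> r}" and ?s = "{y \<in> X. (y, e) \<in> r \<and> y \<noteq> e}"
  note K = principal_segments[OF e]
  \<comment> \<open>Two point evaluations: the upper end of the jump must be sent to a segment with
    \<open>a\<close>, the lower end to one without it.\<close>
  let ?W = "{f \<in> ?H. f ?l \<in> {I \<in> ?K. a \<in> I}} \<inter> {f \<in> ?H. f ?s \<in> {I \<in> ?K. a \<notin> I}}"
  have "openin (order_Homeo_topology ?K (inclusion_order ?K)) ?W"
    by (intro openin_Int openin_order_Homeo_point K openin_segments_containing a)
  moreover have "segment_action h \<in> ?W \<longleftrightarrow> h e = a" if h: "h \<in> carrier (order_Aut X r)" for h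
  proof -
    note inj = order_AutD(3)[OF h]
    have "segment_action h \<in> ?H" using hom_in_carrier[OF segment_action_hom h] .
    then have "segment_action h \<in> ?W \<longleftrightarrow> a \<in> h ` ?l \<and> a \<notin> h ` ?s"
      using K image_initial_segment[OF h] by (simp add: segment_action_def)
    \<comment> \<open>The images of \<open>?l\<close> and \<open>?s\<close> under the injective
      \<open>h\<close> differ in \<open>h e\<close> alone.\<close>
    also have "\<dots> \<longleftrightarrow> h e = a"
      using e inj linear_order_onD(2)[OF r e] by (auto simp: inj_on_def)
    finally show ?thesis .
  qed
  ultimately show thesis by (rule that)
qed

end

section \<open>Discrete embeddings and the equivalence\<close>

text \<open>The set \<open>W\<close> for \<open>x\<close> meets the image only in
  \<open>f x\<close>, so points of the image are open in it; the same sets show that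
  \<open>f\<close> is injective.\<close>

lemma embedding_map_discreteI:
  assumes f: "f ` A \<subseteq> topspace Y"
    and sep: "\<And>x. x \<in> A \<Longrightarrow> \<exists>W. openin Y W \<and> (\<forall>y\<in>A. f y \<in> W \<longleftrightarrow> y = x)"
  shows "embedding_map (discrete_topology A) Y f"
proof -
  let ?Z = "subtopology Y (f ` A)"
  have Z: "topspace ?Z = f ` A" using f by auto
  have inj: "inj_on f A"
    by (rule inj_onI) (metis sep)
  have pt: "openin ?Z {f x}" if x: "x \<in> A" for x
  proof -
    obtain W where W: "openin Y W" "\<forall>y\<in>A. f y \<in> W \<longleftrightarrow> y = x" using sep[OF x] by blast
    then have "{f x} = W \<inter> f ` A" using x by auto
    then show ?thesis unfolding openin_subtopology using W(1) by blast
  qed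
  have "open_map (discrete_topology A) ?Z f"
    unfolding open_map_def
  proof (intro allI impI)
    fix U assume "openin (discrete_topology A) U"
    then have "openin ?Z (\<Union>x\<in>U. {f x})" using pt by (intro openin_Union) auto
    then show "openin ?Z (f ` U)" by (simp add: UNION_singleton_eq_range)
  qed
  moreover have "continuous_map (discrete_topology A) ?Z f" using Z by auto
  ultimately show ?thesis
    unfolding embedding_map_def
    using inj Z by (intro bijective_open_imp_homeomorphic_map) auto
qed

text \<open>\<open>G\<close> acts on itself by translations, and these act on segments. The
  composite separates group elements by the jump at the unit, because translation by
  \<open>y\<close> sends the unit to \<open>y\<close>.\<close>

lemma orderable_imp_segment_embedding:
  assumes G: "group G" and r: "linear_order_on (carrier G) r"
    and inv: "\<forall>g\<in>carrier G. \<forall>x\<in>carrier G. \<forall>y\<in>carrier G.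
             (x, y) \<in> r \<longleftrightarrow> (g \<otimes>\<^bsub>G\<^esub> x, g \<otimes>\<^bsub>G\<^esub> y) \<in> r"
  shows "embeds_in_order_Homeo G (discrete_topology (carrier G)) (initial_segments (carrier G) r)
    (inclusion_order (initial_segments (carrier G) r))"
proof -
  interpret group G by fact
  let ?X = "carrier G"
  let ?K = "initial_segments ?X r"
  let ?t = "\<lambda>g. \<lambda>x\<in>?X. g \<otimes>\<^bsub>G\<^esub> x"
  let ?f = "segment_action ?X r \<circ> ?t"
  have tr: "?t \<in> hom G (order_Aut ?X r)"
    using left_translation_mon[OF G inv] by (simp add: mon_def)
  then have hom: "?f \<in> hom G (order_Homeo ?K (inclusion_order ?K))"
    using segment_action_hom[OF r] by (rule Group.hom_compose)
  moreover have "embedding_map (discrete_topology ?X)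
      (order_Homeo_topology ?K (inclusion_order ?K)) ?f"
  proof (rule embedding_map_discreteI)
    show "?f ` ?X \<subseteq> topspace (order_Homeo_topology ?K (inclusion_order ?K))"
      unfolding topspace_order_Homeo_topology using hom_in_carrier[OF hom] by blast
  next
    fix g assume g: "g \<in> ?X"
    obtain W where W: "openin (order_Homeo_topology ?K (inclusion_order ?K)) W"
      "\<And>h. h \<in> carrier (order_Aut ?X r) \<Longrightarrow> segment_action ?X r h \<in> W \<longleftrightarrow> h \<one>\<^bsub>G\<^esub> = g"
      using openin_segment_action_eq[OF r one_closed g] by blast
    have "?f y \<in> W \<longleftrightarrow> y = g" if "y \<in> ?X" for y
      using W(2)[OF hom_in_carrier[OF tr that]] that by simp
    with W(1) show "\<exists>W. openin (order_Homeo_topology ?K (inclusion_order ?K)) W \<and>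
        (\<forall>y\<in>?X. ?f y \<in> W \<longleftrightarrow> y = g)" by blast
  qed
  ultimately show ?thesis
    unfolding embeds_in_order_Homeo_def by (metis topspace_discrete_topology)
qed

text \<open>The equivalences name the types in which witnesses are constructed, \<open>'a\<close>
  for the ordered set and \<open>'a set\<close> for the compact space. The last two conjuncts give
  the converses for witnesses in arbitrary types.\<close>

theorem theorem4p2:
  fixes G :: "('a, 'm) monoid_scheme"
  assumes "group G"
  shows
    "(left_linearly_orderable G \<longleftrightarrow>
        orderly TYPE('a set) G (discrete_topology (carrier G))) \<and>
     (left_linearly_orderable G \<longleftrightarrow>
        embeds_in_some_order_Aut TYPE('a) G) \<and>
     (left_linearly_orderable G \<longleftrightarrow>
        (\<exists>(K :: 'a set set) r. compact_linearly_ordered_space K r \<and>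
            embeds_in_order_Homeo G (discrete_topology (carrier G)) K r \<and>
            has_covering_dim (interval_topology K r) 0)) \<and>
     (orderly TYPE('k) G (discrete_topology (carrier G)) \<longrightarrow> left_linearly_orderable G) \<and>
     (embeds_in_some_order_Aut TYPE('x) G \<longrightarrow> left_linearly_orderable G)"
proof -
  have 1: "\<exists>(K :: 'a set set) r. compact_linearly_ordered_space K r \<and>
            embeds_in_order_Homeo G (discrete_topology (carrier G)) K r \<and>
            has_covering_dim (interval_topology K r) 0"
    and 2: "embeds_in_some_order_Aut TYPE('a) G" if orderable: "left_linearly_orderable G"
  proof -
    obtain r where r: "linear_order_on (carrier G) r"
      and inv: "\<forall>g\<in>carrier G. \<forall>x\<in>carrier G. \<forall>y\<in>carrier G.
             (x, y) \<in> r \<longleftrightarrow> (g \<otimes>\<^bsub>G\<^esub> x, g \<otimes>\<^bsub>G\<^esub> y) \<in> r"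
      using orderable unfolding left_linearly_orderable_def by blast
    show "\<exists>(K :: 'a set set) r. compact_linearly_ordered_space K r \<and>
            embeds_in_order_Homeo G (discrete_topology (carrier G)) K r \<and>
            has_covering_dim (interval_topology K r) 0"
      using compact_segment_space[OF r] orderable_imp_segment_embedding[OF assms r inv]
        has_covering_dim_segment_space[OF r] by blast
    show "embeds_in_some_order_Aut TYPE('a) G"
      using r left_translation_mon[OF assms inv] unfolding embeds_in_some_order_Aut_def by blast
  qed
  \<comment> \<open>Forgetting the dimension leads from the strengthened form of (2) to (2), which
    closes the cycle.\<close>
  have 3: "orderly TYPE('a set) G (discrete_topology (carrier G))"
    if "\<exists>(K :: 'a set set) r. compact_linearly_ordered_space K r \<and>
            embeds_in_order_Homeo G (discrete_topology (carrier G)) K r \<and>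
            has_covering_dim (interval_topology K r) 0"
    using that unfolding orderly_def by blast
  show ?thesis
    using 1 2 3 orderly_imp_orderable[OF assms, where ?'k = "'a set"]
      orderly_imp_orderable[OF assms, where ?'k = 'k]
      embeds_in_some_order_Aut_imp_orderable[OF assms, where ?'x = 'a]
      embeds_in_some_order_Aut_imp_orderable[OF assms, where ?'x = 'x]
    by blast
qed

end
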